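(* Let $X$ be a concentric topological space whose regular open algebra $\mathrm{RO}(X)$ is atomless. Then at every point of $X$ there is a local basis that is a W-representative in $\langle\mathrm{RO}(X),\mathsf{C}_{\mathrm{T}}\rangle$.
   Context: A topological space $X$ is concentric iff it is $T_1$ and every $p\in X$ has a local basis $\mathcal{B}^p$ such that for all $U,V\in\mathcal{B}^p$: $U=V$ or $\mathrm{Cl}\,U\subseteq V$ or $\mathrm{Cl}\,V\subseteq U$. $\mathrm{RO}(X)$ is the Boolean algebra of regular open subsets with $x\cdot y=x\cap y$, $x+y=\mathrm{Int}\,\mathrm{Cl}(x\cup y)$, $-x=\mathrm{Int}(X\setminus x)$; contact $x\mathrel{\mathsf{C}_{\mathrm{T}}} y$ iff $\mathrm{Cl}\,x\cap\mathrm{Cl}\,y\neq\emptyset$; $x\ll y$ iff $\mathrm{Cl}\,x\subseteq y$. An abstractive set is a set $A$ of regions with (r0) $\emptyset\notin A$; (r1) for all $u,v\in A$: $u=v$ or $u\ll v$ or $v\ll u$; (A) there is no non-empty $x\in\mathrm{RO}(X)$ with $x\subseteq y$ for all $y\in A$. For sets of regions, $B\trianglelefteq A$ means: for every $a\in A$ there is $b\in B$ with $b\subseteq a$. An abstractive set $A$ is a W-representative iff for every abstractive set $B$, $B\trianglelefteq A$ implies $A\trianglelefteq B$. *)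

theory Defs
  imports "HOL-Analysis.Analysis"
begin

definition local_basis_at :: "'a topology \<Rightarrow> 'a \<Rightarrow> 'a set set \<Rightarrow> bool" where
  "local_basis_at X p \<B> \<longleftrightarrow>
     (\<forall>U\<in>\<B>. openin X U \<and> p \<in> U) \<and>
     (\<forall>W. openin X W \<and> p \<in> W \<longrightarrow> (\<exists>U\<in>\<B>. U \<subseteq> W))"

definition concentric_space :: "'a topology \<Rightarrow> bool" where
  "concentric_space X \<longleftrightarrow>
     t1_space X \<and>
     (\<forall>p\<in>topspace X. \<exists>\<B>. local_basis_at X p \<B> \<and>
        (\<forall>U\<in>\<B>. \<forall>V\<in>\<B>. U = V \<or> X closure_of U \<subseteq> V \<or> X closure_of V \<subseteq> U))"

definition RO :: "'a topology \<Rightarrow> 'a set set" where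
  "RO X = {x. X interior_of (X closure_of x) = x}"

definition ro_compl :: "'a topology \<Rightarrow> 'a set \<Rightarrow> 'a set" where
  "ro_compl X x = X interior_of (topspace X - x)"

(* The Boolean order of RO X is inclusion, because its meet is intersection;
   its zero is the empty set. *)
definition RO_atom :: "'a topology \<Rightarrow> 'a set \<Rightarrow> bool" where
  "RO_atom X a \<longleftrightarrow>
     a \<in> RO X \<and> a \<noteq> {} \<and> (\<forall>x\<in>RO X. x \<subseteq> a \<longrightarrow> x = {} \<or> x = a)"

definition RO_atomless :: "'a topology \<Rightarrow> bool" where
  "RO_atomless X \<longleftrightarrow> (\<nexists>a. RO_atom X a)"

definition contact :: "'a topology \<Rightarrow> 'a set \<Rightarrow> 'a set \<Rightarrow> bool" where
  "contact X x y \<longleftrightarrow> X closure_of x \<inter> X closure_of y \<noteq> {}"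

definition well_inside :: "'a topology \<Rightarrow> 'a set \<Rightarrow> 'a set \<Rightarrow> bool" where
  "well_inside X x y \<longleftrightarrow> X closure_of x \<subseteq> y"

(* On regions, well_inside is the non-tangential part relation of the contact
   algebra (RO X, contact X): x is not in contact with the complement of y. *)
lemma well_inside_iff_not_contact_compl:
  assumes "y \<in> RO X"
  shows "well_inside X x y \<longleftrightarrow> \<not> contact X x (ro_compl X y)"
proof -
  have "X closure_of (ro_compl X y) = topspace X - y"
    using assms unfolding ro_compl_def RO_def
    by (metis (mono_tags, lifting) closure_of_complement interior_of_complement mem_Collect_eq)
  then show ?thesis
    using closure_of_subset_topspace[of X x]
    unfolding well_inside_def contact_def by blast
qed

definition abstractive_set :: "'a topology \<Rightarrow> 'a set set \<Rightarrow> bool" where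
  "abstractive_set X A \<longleftrightarrow>
     A \<subseteq> RO X \<and>
     {} \<notin> A \<and>
     (\<forall>u\<in>A. \<forall>v\<in>A. u = v \<or> well_inside X u v \<or> well_inside X v u) \<and>
     \<not> (\<exists>x\<in>RO X. x \<noteq> {} \<and> (\<forall>y\<in>A. x \<subseteq> y))"

(* covered_by B A is the relation "B \<unlhd> A": every member of A includes a member of B. *)
definition covered_by :: "'a set set \<Rightarrow> 'a set set \<Rightarrow> bool" where
  "covered_by B A \<longleftrightarrow> (\<forall>a\<in>A. \<exists>b\<in>B. b \<subseteq> a)"

definition W_representative :: "'a topology \<Rightarrow> 'a set set \<Rightarrow> bool" where
  "W_representative X A \<longleftrightarrow>
     abstractive_set X A \<and>
     (\<forall>B. abstractive_set X B \<longrightarrow> covered_by B A \<longrightarrow> covered_by A B)"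

end

theory Submission
  imports Defs
begin

text \<open>
  Replacing the members of a concentric basis at \<open>p\<close> by the interiors of their closures
  keeps the nesting. It also keeps it a basis: a basic set \<open>V\<close> with no basic set well inside it
  would be the least neighbourhood of \<open>p\<close>, so \<open>V = {p}\<close> by \<open>T\<^sub>1\<close>, which is closed
  and hence well inside itself. A non-empty region below all basic sets would likewise be \<open>{p}\<close>,
  an atom, so the basis is abstractive. If an abstractive set \<open>B\<close> covers it,
  then every \<open>b \<in> B\<close> is, by nesting, not disjoint from any basic set, that is, \<open>p\<close> is in its
  closure; and \<open>b\<close> has some \<open>b' \<in> B\<close> well inside it, since otherwise \<open>b\<close> would be a lower bound
  of the basis. Hence \<open>p \<in> b\<close>.
\<close>

text \<open>By \<open>T\<^sub>1\<close>, any other point is missed by some open neighbourhood of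
  \<open>p\<close>, hence by a basic set inside it.\<close>

lemma local_basis_at_Inter:
  assumes "t1_space X" "p \<in> topspace X" "local_basis_at X p \<B>"
  shows "\<Inter>\<B> = {p}"
proof
  have ob: "\<exists>U\<in>\<B>. U \<subseteq> W" if "openin X W" "p \<in> W" for W
    using assms(3) that by (simp add: local_basis_at_def)
  show "\<Inter>\<B> \<subseteq> {p}"
  proof
    fix q assume q: "q \<in> \<Inter>\<B>"
    obtain U where "U \<in> \<B>" "U \<subseteq> topspace X"
      using ob[OF openin_topspace assms(2)] by blast
    with q have qX: "q \<in> topspace X" by blast
    show "q \<in> {p}"
    proof (rule ccontr)
      assume "q \<notin> {p}"
      then obtain W where "openin X W" "p \<in> W" "q \<notin> W"
        using assms(1,2) qX unfolding t1_space_def by (metis singletonI)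
      with ob q show False by blast
    qed
  qed
  show "{p} \<subseteq> \<Inter>\<B>"
    using assms(3) unfolding local_basis_at_def by blast
qed

lemma interior_closure_in_RO: "X interior_of (X closure_of U) \<in> RO X"
proof -
  let ?r = "X interior_of (X closure_of U)"
  have "X closure_of ?r \<subseteq> X closure_of U"
    by (simp add: closure_of_minimal interior_of_subset)
  moreover have "?r \<subseteq> X closure_of ?r"
    by (simp add: closure_of_subset interior_of_subset_topspace)
  ultimately have "X interior_of (X closure_of ?r) = ?r"
    by (simp add: interior_of_maximal interior_of_mono subset_antisym)
  then show ?thesis
    by (simp add: RO_def)
qed

text \<open>A singleton has no proper non-empty subset, so as a region it would be an atom.\<close>

lemma singleton_not_in_RO:
  assumes "RO_atomless X"
  shows "{p} \<notin> RO X"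
  using assms by (auto simp: RO_atomless_def RO_atom_def subset_singleton_iff)

lemma RO_openin:
  assumes "x \<in> RO X"
  shows "openin X x"
proof -
  have "X interior_of (X closure_of x) = x"
    using assms by (simp add: RO_def)
  then show ?thesis
    using openin_interior_of[of X "X closure_of x"] by simp
qed

lemma abstractive_setD:
  assumes "abstractive_set X A" "u \<in> A"
  shows "u \<noteq> {}" "openin X u" "u \<subseteq> X closure_of u"
proof -
  show "u \<noteq> {}" and op: "openin X u"
    using assms by (auto simp: abstractive_set_def RO_openin)
  show "u \<subseteq> X closure_of u"
    using op by (simp add: closure_of_subset openin_subset)
qed

lemma abstractive_set_nested:
  assumes "abstractive_set X A" "u \<in> A" "v \<in> A"
  shows "u = v \<or> X closure_of u \<subseteq> v \<or> X closure_of v \<subseteq> u"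
  using assms by (simp add: abstractive_set_def well_inside_def)

lemma concentric_regular_basis:
  assumes "concentric_space X" "p \<in> topspace X"
  obtains \<B> where "local_basis_at X p \<B>" "\<B> \<subseteq> RO X"
    "\<And>U V. U \<in> \<B> \<Longrightarrow> V \<in> \<B> \<Longrightarrow> U = V \<or> well_inside X U V \<or> well_inside X V U"
proof -
  have t1: "t1_space X"
    using assms(1) by (simp add: concentric_space_def)
  obtain \<A> where bas: "local_basis_at X p \<A>"
    and nested: "\<And>U V. U \<in> \<A> \<Longrightarrow> V \<in> \<A> \<Longrightarrow>
      U = V \<or> X closure_of U \<subseteq> V \<or> X closure_of V \<subseteq> U"
    using assms(1,2) unfolding concentric_space_def by metis
  have op: "openin X U" "p \<in> U" if "U \<in> \<A>" for U
    using bas that by (auto simp: local_basis_at_def)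
  define r where "r U = X interior_of (X closure_of U)" for U
  have sub_r: "U \<subseteq> r U" if "U \<in> \<A>" for U
    unfolding r_def
    using op[OF that] by (simp add: closure_of_subset interior_of_maximal openin_subset)
  have r_sub: "r U \<subseteq> X closure_of U" for U
    unfolding r_def by (rule interior_of_subset)
  \<comment> \<open>Regularising \<open>U\<close> does not enlarge its closure, and regularising
    \<open>V\<close> can only enlarge \<open>V\<close>.\<close>
  have inside_r: "well_inside X (r U) (r V)" if "X closure_of U \<subseteq> V" "V \<in> \<A>" for U V
  proof -
    have "X closure_of (r U) \<subseteq> X closure_of U"
      by (simp add: r_sub closure_of_minimal)
    with that sub_r[of V] show ?thesis unfolding well_inside_def by simp
  qed
  show ?thesis
  proof
    show "r ` \<A> \<subseteq> RO X"
      by (auto simp: r_def interior_closure_in_RO)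
    show "U = V \<or> well_inside X U V \<or> well_inside X V U"
      if "U \<in> r ` \<A>" "V \<in> r ` \<A>" for U V
    proof -
      obtain U' where "U = r U'" "U' \<in> \<A>"
        using \<open>U \<in> r ` \<A>\<close> by auto
      moreover obtain V' where "V = r V'" "V' \<in> \<A>"
        using \<open>V \<in> r ` \<A>\<close> by auto
      ultimately show ?thesis
        using nested[of U' V'] inside_r[of U' V'] inside_r[of V' U'] by metis
    qed
    have "\<exists>U\<in>\<A>. r U \<subseteq> W" if W: "openin X W" "p \<in> W" for W
    proof -
      obtain V where V: "V \<in> \<A>" "V \<subseteq> W"
        using bas W unfolding local_basis_at_def by blast
      \<comment> \<open>\<open>r V\<close> may stick out of \<open>W\<close>, so a basic set with
        its whole closure inside \<open>V\<close> is needed.\<close>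
      have "\<exists>U\<in>\<A>. X closure_of U \<subseteq> V"
      proof (rule ccontr)
        assume no: "\<not> (\<exists>U\<in>\<A>. X closure_of U \<subseteq> V)"
        \<comment> \<open>With one alternative of nesting excluded by \<open>no\<close>,
          \<open>V\<close> is the least basic set, hence the intersection of them all.\<close>
        have "V \<subseteq> U" if "U \<in> \<A>" for U
          using nested[OF that V(1)] no that closure_of_subset[OF openin_subset[OF op(1)[OF V(1)]]]
          by blast
        then have "V = {p}"
          using local_basis_at_Inter[OF t1 assms(2) bas] V(1) by blast
        then have "X closure_of V = V"
          using t1 assms(2) by (simp add: t1_space_closedin_singleton closure_of_closedin)
        then show False using no V(1) by blast
      qed
      with V r_sub show ?thesis by blast
    qed
    moreover have "openin X (r U) \<and> p \<in> r U" if "U \<in> \<A>" for U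
      using sub_r[OF that] op(2)[OF that] by (auto simp: r_def)
    ultimately show "local_basis_at X p (r ` \<A>)"
      by (simp add: local_basis_at_def)
  qed
qed

text \<open>Every neighbourhood of \<open>p\<close> includes a member of \<open>B\<close>, which is
  comparable with \<open>b\<close>; the smaller of the two is non-empty and lies in both.\<close>

lemma abstractive_set_closure_if_covers_local_basis:
  assumes "abstractive_set X B" "local_basis_at X p \<B>" "covered_by B \<B>"
    and "p \<in> topspace X" "b \<in> B"
  shows "p \<in> X closure_of b"
  unfolding in_closure_of
proof (intro conjI allI impI)
  fix W assume "p \<in> W \<and> openin X W"
  then obtain c where c: "c \<in> B" "c \<subseteq> W"
    using assms(2,3) unfolding local_basis_at_def covered_by_def by (meson subset_trans)
  show "\<exists>y. y \<in> b \<and> y \<in> W"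
    using abstractive_set_nested[OF assms(1,5) c(1)] abstractive_setD[OF assms(1,5)]
      abstractive_setD[OF assms(1) c(1)] c(2)
    by blast
qed (fact assms(4))

lemma W_representative_local_basis:
  assumes "local_basis_at X p \<B>" "abstractive_set X \<B>" "p \<in> topspace X"
  shows "W_representative X \<B>"
  unfolding W_representative_def
proof (intro conjI allI impI assms(2))
  fix B assume B: "abstractive_set X B" and cov: "covered_by B \<B>"
  show "covered_by \<B> B"
    unfolding covered_by_def
  proof
    fix b assume b: "b \<in> B"
    then have "b \<in> RO X" "b \<noteq> {}"
      using B by (auto simp: abstractive_set_def)
    then obtain a where a: "a \<in> \<B>" "\<not> b \<subseteq> a"
      using assms(2) unfolding abstractive_set_def by metis
    then obtain c where c: "c \<in> B" "c \<subseteq> a"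
      using cov unfolding covered_by_def by blast
    \<comment> \<open>The other two alternatives of nesting give
      \<open>b \<subseteq> c \<subseteq> a\<close>, against the choice of \<open>a\<close>.\<close>
    have "X closure_of c \<subseteq> b"
      using abstractive_set_nested[OF B b c(1)] abstractive_setD(3)[OF B b] a(2) c(2) by blast
    \<comment> \<open>The closure lemma is applied to \<open>c\<close>, since \<open>p\<close> in
      the closure of \<open>b\<close> would not yet put \<open>p\<close> in
      \<open>b\<close>.\<close>
    then have "p \<in> b"
      using abstractive_set_closure_if_covers_local_basis[OF B assms(1) cov assms(3) c(1)] by blast
    then show "\<exists>a\<in>\<B>. a \<subseteq> b"
      using assms(1) abstractive_setD(2)[OF B b] by (simp add: local_basis_at_def)
  qed
qed

theorem theorem3p6:
  fixes X :: "'a topology"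
  assumes "concentric_space X"
    and "RO_atomless X"
  shows "\<forall>p\<in>topspace X. \<exists>\<B>. local_basis_at X p \<B> \<and> W_representative X \<B>"
proof
  fix p assume p: "p \<in> topspace X"
  obtain \<B> where bas: "local_basis_at X p \<B>" and RO: "\<B> \<subseteq> RO X"
    and nested: "\<And>U V. U \<in> \<B> \<Longrightarrow> V \<in> \<B> \<Longrightarrow> U = V \<or> well_inside X U V \<or> well_inside X V U"
    using concentric_regular_basis[OF assms(1) p] by blast
  have "\<Inter>\<B> = {p}"
    using local_basis_at_Inter[OF _ p bas] assms(1) by (simp add: concentric_space_def)
  \<comment> \<open>A region below all basic sets lies in their intersection \<open>{p}\<close>,
    which atomlessness bars from being a region.\<close>
  have "x = {}" if "x \<in> RO X" "\<forall>y\<in>\<B>. x \<subseteq> y" for x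
  proof -
    have "x \<subseteq> {p}"
      using that(2) \<open>\<Inter>\<B> = {p}\<close> by (metis Inter_greatest)
    moreover have "x \<noteq> {p}"
      using that(1) singleton_not_in_RO[OF assms(2)] by auto
    ultimately show ?thesis
      by (simp add: subset_singleton_iff)
  qed
  then have "\<not> (\<exists>x\<in>RO X. x \<noteq> {} \<and> (\<forall>y\<in>\<B>. x \<subseteq> y))"
    by auto
  moreover have "{} \<notin> \<B>"
    using bas unfolding local_basis_at_def by blast
  ultimately have "abstractive_set X \<B>"
    using RO nested by (simp add: abstractive_set_def)
  then show "\<exists>\<B>. local_basis_at X p \<B> \<and> W_representative X \<B>"
    using W_representative_local_basis[OF bas _ p] bas by auto
qed

end
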